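(* Let $k\geq 2$ be an integer. Every countable graph, and every countable acyclic digraph, is $(1/k)$-majority $(k+1)$-choosable: for every system of lists $(L(v))_{v}$ with $|L(v)|=k+1$ for each vertex $v$, there is a $(1/k)$-majority colouring $\chi$ with $\chi(v)\in L(v)$ for every vertex $v$.
   Context: For a graph, the relevant edges at a vertex $v$ are all edges incident with $v$ (neighbours of $v$); for a digraph, they are the out-edges $v\to u$ (outneighbours of $v$). A $(1/k)$-majority colouring is an assignment $\chi$ of colours to vertices such that for every vertex $v$: if $v$ has finitely many relevant edges, at most a $1/k$ proportion of them are monochromatic (join $v$ to a vertex $u$ with $\chi(u)=\chi(v)$); if $v$ has infinitely many relevant edges, then infinitely many of them join $v$ to a vertex $u$ with $\chi(u)\neq\chi(v)$. A graph/digraph is $(1/k)$-majority $\ell$-choosable if for every system of lists of size $\ell$ there is a $(1/k)$-majority colouring choosing each vertex's colour from its list. An acyclic digraph is one with no directed cycle. *)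

theory Defs
  imports Complex_Main "HOL-Library.Countable_Set"
begin

definition simple_graph :: "'v set \<Rightarrow> 'v set set \<Rightarrow> bool" where
  "simple_graph V E \<longleftrightarrow> (\<forall>e\<in>E. e \<subseteq> V \<and> card e = 2)"

definition simple_digraph :: "'v set \<Rightarrow> ('v \<times> 'v) set \<Rightarrow> bool" where
  "simple_digraph V A \<longleftrightarrow> A \<subseteq> V \<times> V \<and> irrefl A"

definition neighbours :: "'v set set \<Rightarrow> 'v \<Rightarrow> 'v set" where
  "neighbours E v = {u. {v, u} \<in> E}"

definition outneighbours :: "('v \<times> 'v) set \<Rightarrow> 'v \<Rightarrow> 'v set" where
  "outneighbours A v = {u. (v, u) \<in> A}"

text \<open>Here \<open>N v\<close> is the set of other endpoints of the relevant edges at \<open>v\<close>. Since the graphs and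
  digraphs are simple, counting relevant edges at \<open>v\<close> is the same as counting elements of \<open>N v\<close>.\<close>

definition majority_colouring :: "nat \<Rightarrow> 'v set \<Rightarrow> ('v \<Rightarrow> 'v set) \<Rightarrow> ('v \<Rightarrow> 'c) \<Rightarrow> bool" where
  "majority_colouring k V N \<chi> \<longleftrightarrow>
     (\<forall>v\<in>V. if finite (N v)
            then real (card {u \<in> N v. \<chi> u = \<chi> v}) \<le> 1 / real k * real (card (N v))
            else infinite {u \<in> N v. \<chi> u \<noteq> \<chi> v})"

text \<open>The colours come from an arbitrary type \<open>'c\<close>, which has to be an explicit parameter because it
  occurs only in bound variables on the right-hand side.\<close>

definition majority_choosable ::
    "'c itself \<Rightarrow> nat \<Rightarrow> nat \<Rightarrow> 'v set \<Rightarrow> ('v \<Rightarrow> 'v set) \<Rightarrow> bool" where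
  "majority_choosable (_ :: 'c itself) k l V N \<longleftrightarrow>
     (\<forall>L :: 'v \<Rightarrow> 'c set. (\<forall>v\<in>V. finite (L v) \<and> card (L v) = l) \<longrightarrow>
        (\<exists>\<chi>. majority_colouring k V N \<chi> \<and> (\<forall>v\<in>V. \<chi> v \<in> L v)))"

end

theory Submission
  imports Defs
begin

text \<open>Fix an enumeration of the vertices. Every vertex \<open>v\<close> of infinite degree can be given infinitely
  many private neighbours of larger index, so that each vertex is private to at most one \<open>v\<close>. Colouring
  greedily along the enumeration, all vertices get colours such that private neighbours of \<open>v\<close> avoid
  the colour of \<open>v\<close>. Keep these colours on the vertices of infinite degree, and delete from the list of
  each private neighbour of \<open>v\<close> the colour of \<open>v\<close>. The vertices of finite degree still have lists
  of size at least \<open>k\<close>, which is enough to colour any finite set \<open>X\<close> of them with everything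
  else fixed: for graphs minimise the number of monochromatic edges meeting \<open>X\<close>, for acyclic digraphs
  colour the outneighbours first. Compactness passes from finite sets to all vertices of finite degree.\<close>

section \<open>The majority condition in natural numbers\<close>

text \<open>The proportion bound with its denominator cleared, so that all counting stays in
  \<open>nat\<close>. It is meant for finite \<open>N v\<close> only.\<close>

definition majority_at :: "nat \<Rightarrow> ('v \<Rightarrow> 'v set) \<Rightarrow> ('v \<Rightarrow> 'c) \<Rightarrow> 'v \<Rightarrow> bool" where
  "majority_at k N \<chi> v \<longleftrightarrow> k * card {u \<in> N v. \<chi> u = \<chi> v} \<le> card (N v)"

lemma majority_at_cong:
  assumes "\<And>u. u \<in> insert v (N v) \<Longrightarrow> \<chi> u = \<chi>' u"
  shows "majority_at k N \<chi> v \<longleftrightarrow> majority_at k N \<chi>' v"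
proof -
  have "{u \<in> N v. \<chi> u = \<chi> v} = {u \<in> N v. \<chi>' u = \<chi>' v}"
    using assms by auto
  then show ?thesis by (simp add: majority_at_def)
qed

lemma majority_colouring_iff:
  assumes "k > 0"
  shows "majority_colouring k V N \<chi> \<longleftrightarrow>
    (\<forall>v\<in>V. if finite (N v) then majority_at k N \<chi> v else infinite {u \<in> N v. \<chi> u \<noteq> \<chi> v})"
proof -
  have "real a \<le> 1 / real k * real b \<longleftrightarrow> k * a \<le> b" for a b
  proof -
    have "real a \<le> 1 / real k * real b \<longleftrightarrow> real (k * a) \<le> real b"
      using assms by (simp add: field_simps)
    then show ?thesis by (simp only: of_nat_le_iff)
  qed
  then show ?thesis by (simp add: majority_colouring_def majority_at_def)
qed

section \<open>Colouring finitely many vertices of finite degree\<close>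

text \<open>The common interface of graphs and acyclic digraphs. The outside colouring \<psi> is
  arbitrary, and lists of size \<open>k\<close> suffice, so one colour may be deleted from each list
  of size \<open>k + 1\<close>.\<close>

definition finitely_majority_colourable :: "'c itself \<Rightarrow> nat \<Rightarrow> ('v \<Rightarrow> 'v set) \<Rightarrow> bool" where
  "finitely_majority_colourable (_ :: 'c itself) k N \<longleftrightarrow>
     (\<forall>X (C :: 'v \<Rightarrow> 'c set) \<psi>.
        finite X \<and> (\<forall>v\<in>X. finite (N v) \<and> finite (C v) \<and> k \<le> card (C v)) \<longrightarrow>
        (\<exists>\<chi>. (\<forall>v. v \<notin> X \<longrightarrow> \<chi> v = \<psi> v) \<and> (\<forall>v\<in>X. \<chi> v \<in> C v \<and> majority_at k N \<chi> v)))"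

text \<open>Pigeonhole: colour classes are disjoint, so if each of at least \<open>k\<close> colours
  took more than a \<open>1/k\<close> share of \<open>M\<close>, the shares would exceed
  \<open>card M\<close>.\<close>

lemma ex_rare_colour:
  assumes "finite M" "finite C" "k \<le> card C" "k > 0"
  shows "\<exists>c\<in>C. k * card {u \<in> M. \<chi> u = c} \<le> card M"
proof (rule ccontr)
  assume "\<not> ?thesis"
  then have big: "card M + 1 \<le> k * card {u \<in> M. \<chi> u = c}" if "c \<in> C" for c
    using that by (auto simp: not_le)
  have "k * (card M + 1) \<le> card C * (card M + 1)"
    using assms by (intro mult_right_mono) auto
  also have "\<dots> = (\<Sum>c\<in>C. card M + 1)" by simp
  also have "\<dots> \<le> (\<Sum>c\<in>C. k * card {u \<in> M. \<chi> u = c})"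
    using big by (intro sum_mono)
  also have "\<dots> = k * card (\<Union>c\<in>C. {u \<in> M. \<chi> u = c})"
    using assms by (subst card_UN_disjoint) (auto simp: sum_distrib_left)
  also have "\<dots> \<le> k * card M"
    using assms by (intro mult_left_mono card_mono) auto
  finally show False using \<open>k > 0\<close> by simp
qed

text \<open>At a minimum of the number of monochromatic edges meeting \<open>X\<close>, moving
  \<open>v\<close> to a rare colour gains nothing, so the present colour of \<open>v\<close> is at
  least as rare among its neighbours.\<close>

lemma finitely_majority_colourable_graph:
  assumes "simple_graph V E" "k > 0"
  shows "finitely_majority_colourable TYPE('c) k (neighbours E)"
  unfolding finitely_majority_colourable_def
proof (intro allI impI, elim conjE)
  fix X :: "'a set" and C :: "'a \<Rightarrow> 'c set" and \<psi>
  assume X: "finite X"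
    and C: "\<forall>v\<in>X. finite (neighbours E v) \<and> finite (C v) \<and> k \<le> card (C v)"
  let ?N = "neighbours E"
  have card_edge: "card e = 2" if "e \<in> E" for e
    using assms that by (auto simp: simple_graph_def)
  have edge_at: "\<exists>u. e = {v, u}" if "e \<in> E" "v \<in> e" for e v
    using card_edge[OF that(1)] that(2) by (auto simp: card_2_iff)
  have irrefl: "v \<notin> ?N v" for v
    using card_edge[of "{v, v}"] by (auto simp: neighbours_def)
  \<comment> \<open>Recolouring \<open>X\<close> affects only edges that meet \<open>X\<close>.
    There are finitely many of them, even if \<open>E\<close> is infinite.\<close>
  define D where "D = {e \<in> E. e \<inter> X \<noteq> {}}"
  have "D \<subseteq> (\<Union>v\<in>X. (\<lambda>u. {v, u}) ` ?N v)"
  proof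
    fix e assume "e \<in> D"
    then obtain v where v: "e \<in> E" "v \<in> X" "v \<in> e" by (auto simp: D_def)
    then obtain u where "e = {v, u}" using edge_at by blast
    with v show "e \<in> (\<Union>v\<in>X. (\<lambda>u. {v, u}) ` ?N v)" by (auto simp: neighbours_def)
  qed
  then have "finite D" by (rule finite_subset) (use X C in auto)
  define mono_edge where "mono_edge \<chi> e \<longleftrightarrow> (\<forall>x\<in>e. \<forall>y\<in>e. \<chi> x = \<chi> y)" for \<chi> :: "'a \<Rightarrow> 'c" and e
  define \<Phi> where "\<Phi> \<chi> = card {e \<in> D. mono_edge \<chi> e}" for \<chi>
  \<comment> \<open>Isolates the share of \<open>v\<close> in \<Phi>: as \<open>v \<in> X\<close>,
    all edges at \<open>v\<close> lie in \<open>D\<close>, and they correspond to neighbours via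
    \<open>u \<mapsto> {v, u}\<close>.\<close>
  have split: "\<Phi> \<chi> = card {e \<in> D. v \<notin> e \<and> mono_edge \<chi> e} + card {u \<in> ?N v. \<chi> u = \<chi> v}"
    if "v \<in> X" for \<chi> v
  proof -
    have "{e \<in> D. v \<in> e \<and> mono_edge \<chi> e} = (\<lambda>u. {v, u}) ` {u \<in> ?N v. \<chi> u = \<chi> v}"
    proof (intro equalityI subsetI)
      fix e assume "e \<in> {e \<in> D. v \<in> e \<and> mono_edge \<chi> e}"
      then have e: "e \<in> E" "v \<in> e" "mono_edge \<chi> e" by (auto simp: D_def)
      then obtain u where u: "e = {v, u}" using edge_at by blast
      have "u \<in> ?N v" using e(1) u by (simp add: neighbours_def)
      moreover have "\<chi> u = \<chi> v" using e(3) u unfolding mono_edge_def by blast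
      ultimately show "e \<in> (\<lambda>u. {v, u}) ` {u \<in> ?N v. \<chi> u = \<chi> v}" using u by blast
    next
      fix e assume "e \<in> (\<lambda>u. {v, u}) ` {u \<in> ?N v. \<chi> u = \<chi> v}"
      then obtain u where "e = {v, u}" "{v, u} \<in> E" "\<chi> u = \<chi> v"
        by (auto simp: neighbours_def)
      then show "e \<in> {e \<in> D. v \<in> e \<and> mono_edge \<chi> e}"
        using that by (simp add: D_def mono_edge_def)
    qed
    moreover have "inj_on (\<lambda>u. {v, u}) {u \<in> ?N v. \<chi> u = \<chi> v}"
      by (auto simp: inj_on_def doubleton_eq_iff)
    ultimately have at_v: "card {e \<in> D. v \<in> e \<and> mono_edge \<chi> e} = card {u \<in> ?N v. \<chi> u = \<chi> v}"
      by (simp add: card_image)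
    have "{e \<in> D. mono_edge \<chi> e} = {e \<in> D. v \<notin> e \<and> mono_edge \<chi> e} \<union> {e \<in> D. v \<in> e \<and> mono_edge \<chi> e}"
      by auto
    then have "\<Phi> \<chi> = card {e \<in> D. v \<notin> e \<and> mono_edge \<chi> e} + card {e \<in> D. v \<in> e \<and> mono_edge \<chi> e}"
      unfolding \<Phi>_def using \<open>finite D\<close> by (simp add: card_Un_disjoint disjoint_iff)
    with at_v show ?thesis by simp
  qed
  define P where "P \<chi> \<longleftrightarrow> (\<forall>v. v \<notin> X \<longrightarrow> \<chi> v = \<psi> v) \<and> (\<forall>v\<in>X. \<chi> v \<in> C v)" for \<chi>
  \<comment> \<open>Nonempty lists make \<open>P\<close> satisfiable; a minimum of \<Phi> then
    exists because its values are natural numbers.\<close>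
  have "C v \<noteq> {}" if "v \<in> X" for v
    using C \<open>k > 0\<close> that by fastforce
  then have "P (\<lambda>v. if v \<in> X then SOME c. c \<in> C v else \<psi> v)"
    by (auto simp: P_def some_in_eq)
  then obtain \<chi> where \<chi>: "P \<chi>" and least: "\<And>\<chi>'. P \<chi>' \<Longrightarrow> \<Phi> \<chi> \<le> \<Phi> \<chi>'"
    using ex_has_least_nat[of P _ \<Phi>] by blast
  have "majority_at k ?N \<chi> v" if v: "v \<in> X" for v
  proof -
    obtain c where c: "c \<in> C v" "k * card {u \<in> ?N v. \<chi> u = c} \<le> card (?N v)"
      using ex_rare_colour[of "?N v" "C v" k \<chi>] C v \<open>k > 0\<close> by blast
    let ?\<chi>' = "\<chi>(v := c)"
    have "P ?\<chi>'" using \<chi> c v by (auto simp: P_def)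
    then have "\<Phi> \<chi> \<le> \<Phi> ?\<chi>'" by (rule least)
    \<comment> \<open>Recolouring \<open>v\<close> changes neither the edges avoiding
      \<open>v\<close> nor, in the absence of loops, the colours of its neighbours.\<close>
    moreover have "{e \<in> D. v \<notin> e \<and> mono_edge ?\<chi>' e} = {e \<in> D. v \<notin> e \<and> mono_edge \<chi> e}"
      by (auto simp: mono_edge_def)
    moreover have "{u \<in> ?N v. ?\<chi>' u = ?\<chi>' v} = {u \<in> ?N v. \<chi> u = c}"
      using irrefl by auto
    ultimately have "card {u \<in> ?N v. \<chi> u = \<chi> v} \<le> card {u \<in> ?N v. \<chi> u = c}"
      using split[OF v, of \<chi>] split[OF v, of ?\<chi>'] by simp
    then have "k * card {u \<in> ?N v. \<chi> u = \<chi> v} \<le> k * card {u \<in> ?N v. \<chi> u = c}"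
      by (rule mult_le_mono2)
    with c(2) show ?thesis unfolding majority_at_def by (rule order_trans[rotated])
  qed
  with \<chi> show "\<exists>\<chi>. (\<forall>v. v \<notin> X \<longrightarrow> \<chi> v = \<psi> v) \<and>
      (\<forall>v\<in>X. \<chi> v \<in> C v \<and> majority_at k ?N \<chi> v)"
    by (auto simp: P_def)
qed

lemma finite_acyclic_ex_source:
  assumes "finite X" "X \<noteq> {}" "acyclic A"
  shows "\<exists>v\<in>X. \<forall>w\<in>X. (w, v) \<notin> A"
proof -
  have "acyclic (A \<inter> X \<times> X)" using \<open>acyclic A\<close> by (rule acyclic_subset) auto
  moreover have "finite (A \<inter> X \<times> X)" using \<open>finite X\<close> by auto
  ultimately have "wf (A \<inter> X \<times> X)" by (rule finite_acyclic_wf[rotated])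
  then obtain v where "v \<in> X" "\<And>w. (w, v) \<in> A \<inter> X \<times> X \<Longrightarrow> w \<notin> X"
    using \<open>X \<noteq> {}\<close> by (metis all_not_in_conv wfE_min)
  then show ?thesis by blast
qed

text \<open>Induction on \<open>X\<close>: a vertex \<open>v\<close> with no inneighbour in
  \<open>X\<close> is coloured last. Its outneighbours then have their final colours, and no other
  vertex of \<open>X\<close> counts the colour of \<open>v\<close>.\<close>

lemma finitely_majority_colourable_acyclic_digraph:
  assumes "acyclic A" "k > 0"
  shows "finitely_majority_colourable TYPE('c) k (outneighbours A)"
  unfolding finitely_majority_colourable_def
proof (intro allI impI, elim conjE)
  fix X :: "'a set" and C :: "'a \<Rightarrow> 'c set" and \<psi>
  let ?N = "outneighbours A"
  assume "finite X" "\<forall>v\<in>X. finite (?N v) \<and> finite (C v) \<and> k \<le> card (C v)"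
  then show "\<exists>\<chi>. (\<forall>v. v \<notin> X \<longrightarrow> \<chi> v = \<psi> v) \<and>
      (\<forall>v\<in>X. \<chi> v \<in> C v \<and> majority_at k ?N \<chi> v)"
  proof (induction X rule: finite_psubset_induct)
    case (psubset X)
    show ?case
    proof (cases "X = {}")
      case False
      then obtain v where v: "v \<in> X" and source: "\<And>w. w \<in> X \<Longrightarrow> v \<notin> ?N w"
        using finite_acyclic_ex_source[OF psubset.hyps _ \<open>acyclic A\<close>]
        by (auto simp: outneighbours_def)
      obtain \<chi> where \<chi>: "\<And>w. w \<notin> X - {v} \<Longrightarrow> \<chi> w = \<psi> w"
          "\<And>w. w \<in> X - {v} \<Longrightarrow> \<chi> w \<in> C w \<and> majority_at k ?N \<chi> w"
        using psubset.IH[of "X - {v}"] psubset.prems v by blast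
      obtain c where c: "c \<in> C v" "k * card {u \<in> ?N v. \<chi> u = c} \<le> card (?N v)"
        using ex_rare_colour[of "?N v" "C v" k \<chi>] psubset.prems v \<open>k > 0\<close> by blast
      let ?\<chi>' = "\<chi>(v := c)"
      \<comment> \<open>The source property for \<open>v\<close> itself rules out a loop at
        \<open>v\<close>.\<close>
      have "{u \<in> ?N v. ?\<chi>' u = ?\<chi>' v} = {u \<in> ?N v. \<chi> u = c}"
        using source[OF v] by auto
      then have "majority_at k ?N ?\<chi>' v" using c(2) by (simp add: majority_at_def)
      moreover have "majority_at k ?N ?\<chi>' w" if w: "w \<in> X - {v}" for w
      proof -
        have "majority_at k ?N ?\<chi>' w \<longleftrightarrow> majority_at k ?N \<chi> w"
          by (rule majority_at_cong) (use w source in auto)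
        then show ?thesis using \<chi>(2)[OF w] by simp
      qed
      ultimately have "(\<forall>w. w \<notin> X \<longrightarrow> ?\<chi>' w = \<psi> w) \<and>
          (\<forall>w\<in>X. ?\<chi>' w \<in> C w \<and> majority_at k ?N ?\<chi>' w)"
        using \<chi> c(1) v by auto
      then show ?thesis by blast
    qed auto
  qed
qed

section \<open>Compactness\<close>

lemma ex_cluster_colouring:
  fixes \<chi> :: "nat \<Rightarrow> 'v \<Rightarrow> 'c"
  assumes "countable F" and fin: "\<And>v. v \<in> F \<Longrightarrow> finite (range (\<lambda>n. \<chi> n v))"
  shows "\<exists>\<phi>. \<forall>S. finite S \<and> S \<subseteq> F \<longrightarrow> infinite {n. \<forall>v\<in>S. \<chi> n v = \<phi> v}"
proof -
  define e where "e = from_nat_into F"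
  \<comment> \<open>One thinning, by pigeonhole on the finitely many colours of \<open>e m\<close>.
    The guard \<open>e m \<in> F\<close> covers an empty \<open>F\<close>, where \<open>e m\<close>
    is arbitrary.\<close>
  have step: "\<exists>J. infinite J \<and> J \<subseteq> I \<and> (\<exists>c. e m \<in> F \<longrightarrow> (\<forall>n\<in>J. \<chi> n (e m) = c))"
    if "infinite I" for I m
  proof (cases "e m \<in> F")
    case True
    then have "finite ((\<lambda>n. \<chi> n (e m)) ` I)"
      by (rule finite_subset[OF _ fin, rotated]) auto
    then obtain i where "infinite {n \<in> I. \<chi> n (e m) = \<chi> i (e m)}"
      using pigeonhole_infinite[OF \<open>infinite I\<close>] by blast
    then show ?thesis by (intro exI[of _ "{n \<in> I. \<chi> n (e m) = \<chi> i (e m)}"]) auto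
  qed (use that in auto)
  have "\<exists>I. \<forall>m. infinite (I m) \<and>
      (I (Suc m) \<subseteq> I m \<and> (\<exists>c. e m \<in> F \<longrightarrow> (\<forall>n\<in>I (Suc m). \<chi> n (e m) = c)))"
    by (rule dependent_nat_choice) (use step infinite_UNIV_nat in blast)+
  then obtain I where I: "\<forall>m. infinite (I m) \<and>
      (I (Suc m) \<subseteq> I m \<and> (\<exists>c. e m \<in> F \<longrightarrow> (\<forall>n\<in>I (Suc m). \<chi> n (e m) = c)))" ..
  then have inf: "infinite (I m)" and dec: "I (Suc m) \<subseteq> I m" for m by simp_all
  have "\<forall>m. \<exists>c. e m \<in> F \<longrightarrow> (\<forall>n\<in>I (Suc m). \<chi> n (e m) = c)" using I by simp
  then obtain c where "\<forall>m. e m \<in> F \<longrightarrow> (\<forall>n\<in>I (Suc m). \<chi> n (e m) = c m)"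
    by (rule choice[THEN exE])
  then have c: "\<chi> n (e m) = c m" if "e m \<in> F" "n \<in> I (Suc m)" for m n
    using that by simp
  define \<phi> where "\<phi> v = c (to_nat_on F v)" for v
  have "infinite {n. \<forall>v\<in>S. \<chi> n v = \<phi> v}" if S: "finite S" "S \<subseteq> F" for S
  proof -
    \<comment> \<open>The colour of vertex number \<open>j\<close> is frozen on
      \<open>I (Suc j)\<close>, so a strict upper bound \<open>m\<close> on the indices in
      \<open>S\<close> makes all of \<open>S\<close> frozen on \<open>I m\<close>.\<close>
    obtain m where m: "\<And>v. v \<in> S \<Longrightarrow> to_nat_on F v < m"
      using S(1) finite_nat_set_iff_bounded[of "to_nat_on F ` S"] by auto
    have "\<chi> n v = \<phi> v" if "n \<in> I m" "v \<in> S" for n v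
    proof -
      have "e (to_nat_on F v) = v"
        using S(2) that(2) \<open>countable F\<close> by (auto simp: e_def)
      moreover have "I m \<subseteq> I (Suc (to_nat_on F v))"
        using m[OF that(2)] by (intro lift_Suc_antimono_le[of I, OF dec]) auto
      ultimately show ?thesis using c[of "to_nat_on F v" n] S(2) that by (auto simp: \<phi>_def)
    qed
    then have "I m \<subseteq> {n. \<forall>v\<in>S. \<chi> n v = \<phi> v}" by blast
    with inf[of m] show ?thesis by (rule infinite_super[rotated])
  qed
  then show ?thesis by blast
qed

text \<open>Finite initial segments \<open>X n\<close> of \<open>F\<close> are coloured separately.
  The condition at \<open>v\<close> involves only the finite set \<open>insert v (N v)\<close>, so a
  cluster colouring inherits it.\<close>

lemma finitely_majority_colourable_compactness:
  fixes C :: "'v \<Rightarrow> 'c set"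
  assumes loc: "finitely_majority_colourable TYPE('c) k N" and "countable F"
    and F: "\<And>v. v \<in> F \<Longrightarrow> finite (N v) \<and> finite (C v) \<and> k \<le> card (C v)"
  shows "\<exists>\<chi>. (\<forall>v. v \<notin> F \<longrightarrow> \<chi> v = \<psi> v) \<and> (\<forall>v\<in>F. \<chi> v \<in> C v \<and> majority_at k N \<chi> v)"
proof -
  define X where "X n = {v \<in> F. to_nat_on F v < n}" for n
  have "finite (X n)" for n
  proof (rule finite_imageD)
    show "finite (to_nat_on F ` X n)"
      by (rule finite_subset[of _ "{..<n}"]) (auto simp: X_def)
    show "inj_on (to_nat_on F) (X n)"
      using inj_on_to_nat_on[OF \<open>countable F\<close>] by (rule inj_on_subset) (auto simp: X_def)
  qed
  then have "\<exists>\<chi>. (\<forall>v. v \<notin> X n \<longrightarrow> \<chi> v = \<psi> v) \<and>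
      (\<forall>v\<in>X n. \<chi> v \<in> C v \<and> majority_at k N \<chi> v)" for n
    using loc[unfolded finitely_majority_colourable_def, rule_format, of "X n" C \<psi>] F
    by (auto simp: X_def)
  then obtain \<chi> where out: "\<And>n v. v \<notin> X n \<Longrightarrow> \<chi> n v = \<psi> v"
    and ins: "\<And>n v. v \<in> X n \<Longrightarrow> \<chi> n v \<in> C v \<and> majority_at k N (\<chi> n) v"
    by metis
  have "finite (range (\<lambda>n. \<chi> n v))" if "v \<in> F" for v
  proof (rule finite_subset)
    \<comment> \<open>The value \<open>\<psi> v\<close> occurs as long as \<open>v\<close> is not
      yet in \<open>X n\<close>.\<close>
    show "range (\<lambda>n. \<chi> n v) \<subseteq> insert (\<psi> v) (C v)" using out ins by blast
  qed (use F that in auto)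
  then obtain \<phi> where \<phi>: "\<And>S. finite S \<Longrightarrow> S \<subseteq> F \<Longrightarrow> infinite {n. \<forall>v\<in>S. \<chi> n v = \<phi> v}"
    using ex_cluster_colouring[OF \<open>countable F\<close>, of \<chi>] by blast
  define \<chi>' where "\<chi>' v = (if v \<in> F then \<phi> v else \<psi> v)" for v
  have "\<chi>' v \<in> C v \<and> majority_at k N \<chi>' v" if v: "v \<in> F" for v
  proof -
    let ?S = "insert v (N v) \<inter> F"
    have "infinite {n. \<forall>v\<in>?S. \<chi> n v = \<phi> v}" using F[OF v] by (intro \<phi>) auto
    \<comment> \<open>Infinitely many agreeing \<open>n\<close> are needed here: one must be large
      enough that \<open>v \<in> X n\<close>.\<close>
    then obtain n where n: "n > to_nat_on F v" "\<And>u. u \<in> ?S \<Longrightarrow> \<chi> n u = \<phi> u"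
      unfolding infinite_nat_iff_unbounded by blast
    have agree: "\<chi>' u = \<chi> n u" if "u \<in> insert v (N v)" for u
      using n(2)[of u] out[of u n] that by (auto simp: \<chi>'_def X_def)
    have "v \<in> X n" using v n(1) by (simp add: X_def)
    with ins[OF this] show ?thesis
      using agree majority_at_cong[of v N \<chi>' "\<chi> n" k] by simp
  qed
  then show ?thesis by (intro exI[of _ \<chi>']) (auto simp: \<chi>'_def)
qed

section \<open>Private neighbours of vertices of infinite degree\<close>

text \<open>At time \<open>t\<close> the vertex \<open>g t\<close> receives a neighbour
  \<open>u t\<close> whose index exceeds that of \<open>g t\<close> and of all earlier choices;
  increasing indices make \<open>u\<close> injective.\<close>

lemma ex_private_neighbours:
  fixes N :: "'v \<Rightarrow> 'v set"
  assumes "countable V" and N: "\<And>v. v \<in> V \<Longrightarrow> N v \<subseteq> V"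
    and W: "W \<subseteq> V" "W \<noteq> {}" "\<And>v. v \<in> W \<Longrightarrow> infinite (N v)"
  obtains g u :: "nat \<Rightarrow> 'v" where "inj u" "\<And>t. g t \<in> W" "\<And>t. u t \<in> N (g t)"
    "\<And>t. to_nat_on V (g t) < to_nat_on V (u t)" "\<And>v. v \<in> W \<Longrightarrow> infinite {t. g t = v}"
proof -
  define i where "i = to_nat_on V"
  \<comment> \<open>The first component of a decoded pair takes every value infinitely often, so
    each vertex of \<open>W\<close> gets infinitely many turns.\<close>
  define g where "g t = from_nat_into W (fst (prod_decode t))" for t
  have g: "g t \<in> W" for t
    using W(2) by (simp add: g_def from_nat_into)
  have next_nbr: "\<exists>x. x \<in> N v \<and> m < i x" if "v \<in> W" for v m
  proof (rule ccontr)
    assume "\<not> ?thesis"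
    then have "i ` N v \<subseteq> {..m}" by (auto simp: not_less)
    then have "finite (i ` N v)" by (rule finite_subset) simp
    moreover have "inj_on i (N v)"
      unfolding i_def using inj_on_to_nat_on[OF \<open>countable V\<close>]
      by (rule inj_on_subset) (use N W(1) that in auto)
    ultimately show False using W(3)[OF that] finite_imageD by blast
  qed
  have "\<exists>u. \<forall>t. (u t \<in> N (g t) \<and> i (g t) < i (u t)) \<and> i (u t) < i (u (Suc t))"
  proof (rule dependent_nat_choice)
    fix x t
    show "\<exists>y. (y \<in> N (g (Suc t)) \<and> i (g (Suc t)) < i y) \<and> i x < i y"
      using next_nbr[OF g[of "Suc t"], of "max (i x) (i (g (Suc t)))"] by auto
  qed (use next_nbr[OF g] in blast)
  then obtain u where u: "\<And>t. u t \<in> N (g t)" "\<And>t. i (g t) < i (u t)"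
    "\<And>t. i (u t) < i (u (Suc t))" by blast
  have "strict_mono (\<lambda>t. i (u t))" using u(3) by (simp add: strict_mono_Suc_iff)
  then have "inj (\<lambda>t. i (u t))" by (rule strict_mono_imp_inj_on)
  then have "inj u" by (auto simp: inj_def)
  moreover have "infinite {t. g t = v}" if "v \<in> W" for v
  proof -
    have "countable W" using \<open>countable V\<close> W(1) by (rule countable_subset[rotated])
    then have "range (\<lambda>j. prod_encode (to_nat_on W v, j)) \<subseteq> {t. g t = v}"
      using that by (auto simp: g_def)
    moreover have "infinite (range (\<lambda>j. prod_encode (to_nat_on W v, j)))"
      by (rule range_inj_infinite) (auto simp: inj_def)
    ultimately show ?thesis by (rule infinite_super)
  qed
  ultimately show ?thesis using that[of u g] g u(1,2) by (simp add: i_def)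
qed

section \<open>From finite sets to choosability\<close>

lemma majority_choosable_if_finitely_majority_colourable:
  fixes V :: "'v set"
  assumes loc: "finitely_majority_colourable TYPE('c) k N" and "k > 0" "countable V"
    and N: "\<And>v. v \<in> V \<Longrightarrow> N v \<subseteq> V"
  shows "majority_choosable TYPE('c) k (k + 1) V N"
  unfolding majority_choosable_def
proof (intro allI impI)
  fix L :: "'v \<Rightarrow> 'c set"
  assume L: "\<forall>v\<in>V. finite (L v) \<and> card (L v) = k + 1"
  define W where "W = {v \<in> V. infinite (N v)}"
  define F where "F = V - W"
  have "countable F" using \<open>countable V\<close> by (simp add: F_def)
  show "\<exists>\<chi>. majority_colouring k V N \<chi> \<and> (\<forall>v\<in>V. \<chi> v \<in> L v)"
  proof (cases "W = {}")
    case True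
    \<comment> \<open>Here \<open>F = V\<close>, so a dummy value serves as the outside
      colouring.\<close>
    have "\<exists>\<chi>. (\<forall>v. v \<notin> F \<longrightarrow> \<chi> v = undefined v) \<and>
        (\<forall>v\<in>F. \<chi> v \<in> L v \<and> majority_at k N \<chi> v)"
      by (rule finitely_majority_colourable_compactness[OF loc \<open>countable F\<close>])
        (use L in \<open>auto simp: F_def W_def\<close>)
    then obtain \<chi> where "\<And>v. v \<in> F \<Longrightarrow> \<chi> v \<in> L v \<and> majority_at k N \<chi> v" by blast
    with True show ?thesis
      using \<open>k > 0\<close> by (intro exI[of _ \<chi>]) (auto simp: majority_colouring_iff F_def W_def)
  next
    case False
    obtain g u :: "nat \<Rightarrow> 'v" where "inj u" and gW: "\<And>t. g t \<in> W" and uN: "\<And>t. u t \<in> N (g t)"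
      and less: "\<And>t. to_nat_on V (g t) < to_nat_on V (u t)"
      and inf: "\<And>v. v \<in> W \<Longrightarrow> infinite {t. g t = v}"
    proof (rule ex_private_neighbours[OF \<open>countable V\<close>, of N W])
    qed (use N False in \<open>auto simp: W_def\<close>)
    \<comment> \<open>The colours that \<open>v\<close> must avoid as a private neighbour: at most
      one, as \<open>u\<close> is injective.\<close>
    define B where "B \<chi> v = {\<chi> (g t) | t. u t = v}" for \<chi> :: "'v \<Rightarrow> 'c" and v
    have B: "finite (B \<chi> v) \<and> card (B \<chi> v) \<le> 1" for \<chi> v
    proof (cases "v \<in> range u")
      case True
      then obtain t where "v = u t" by blast
      then have "B \<chi> v = {\<chi> (g t)}" using \<open>inj u\<close> by (auto simp: B_def inj_def)
      then show ?thesis by simp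
    next
      case False
      then have "B \<chi> v = {}" by (auto simp: B_def)
      then show ?thesis by simp
    qed
    have card_diff: "k \<le> card (L v - B \<chi> v)" if "v \<in> V" for \<chi> v
      using diff_card_le_card_Diff[of "B \<chi> v" "L v"] B[where \<chi>=\<chi> and v=v] L that by fastforce
    \<comment> \<open>Greedy colouring as well-founded recursion on the index:
      \<open>B \<psi> v\<close> looks only at vertices \<open>g t\<close> with
      \<open>u t = v\<close>, whose index is smaller.\<close>
    have "\<exists>\<psi>. \<forall>v. v \<in> V \<longrightarrow> \<psi> v \<in> L v - B \<psi> v"
    proof (rule dependent_wf_choice[where R = "measure (to_nat_on V)"])
      fix f h :: "'v \<Rightarrow> 'c" and v r
      assume "\<And>w. (w, v) \<in> measure (to_nat_on V) \<Longrightarrow> f w = h w"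
      then have "B f v = B h v" using less by (force simp: B_def)
      then show "(v \<in> V \<longrightarrow> r \<in> L v - B f v) = (v \<in> V \<longrightarrow> r \<in> L v - B h v)" by simp
    next
      fix v and f :: "'v \<Rightarrow> 'c"
      have "L v - B f v \<noteq> {}" if "v \<in> V"
        using card_diff[OF that, of f] \<open>k > 0\<close> by (metis card.empty not_le)
      then show "\<exists>r. v \<in> V \<longrightarrow> r \<in> L v - B f v" by blast
    qed simp
    then obtain \<psi> where \<psi>: "\<And>v. v \<in> V \<Longrightarrow> \<psi> v \<in> L v - B \<psi> v" by blast
    \<comment> \<open>The deleted colours are computed from \<psi>. They stay correct for \<chi>,
      since every \<open>g t\<close> lies in \<open>W\<close> and keeps its colour.\<close>
    have "\<exists>\<chi>. (\<forall>v. v \<notin> F \<longrightarrow> \<chi> v = \<psi> v) \<and>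
        (\<forall>v\<in>F. \<chi> v \<in> L v - B \<psi> v \<and> majority_at k N \<chi> v)"
      by (rule finitely_majority_colourable_compactness[OF loc \<open>countable F\<close>])
        (use L card_diff in \<open>auto simp: F_def W_def\<close>)
    then obtain \<chi> where out: "\<And>v. v \<notin> F \<Longrightarrow> \<chi> v = \<psi> v"
      and ins: "\<And>v. v \<in> F \<Longrightarrow> \<chi> v \<in> L v - B \<psi> v \<and> majority_at k N \<chi> v" by blast
    \<comment> \<open>A private neighbour may itself have infinite degree; it then keeps its
      \<psi>-colour, which already avoids \<open>B \<psi> v\<close>.\<close>
    have \<chi>: "\<chi> v \<in> L v - B \<psi> v" if "v \<in> V" for v
      using ins[of v] out[of v] \<psi>[OF that] by (cases "v \<in> F") auto
    have "infinite {x \<in> N v. \<chi> x \<noteq> \<chi> v}" if v: "v \<in> W" for v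
    proof -
      have "u t \<in> {x \<in> N v. \<chi> x \<noteq> \<chi> v}" if "g t = v" for t
      proof -
        have "u t \<in> N v" using uN[of t] that by simp
        then have "u t \<in> V" using N v by (auto simp: W_def)
        then have "\<chi> (u t) \<noteq> \<psi> v" using \<chi>[of "u t"] that by (auto simp: B_def)
        moreover have "\<chi> v = \<psi> v" using out[of v] v by (simp add: F_def)
        ultimately show ?thesis using \<open>u t \<in> N v\<close> by simp
      qed
      then have "u ` {t. g t = v} \<subseteq> {x \<in> N v. \<chi> x \<noteq> \<chi> v}" by blast
      \<comment> \<open>Injectivity of \<open>u\<close> turns infinitely many times into infinitely
        many distinct neighbours.\<close>
      moreover have "infinite (u ` {t. g t = v})"
        using inf[OF v] \<open>inj u\<close> by (simp add: finite_image_iff inj_on_subset)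
      ultimately show ?thesis by (rule infinite_super)
    qed
    then have "majority_colouring k V N \<chi>"
      using ins \<open>k > 0\<close> by (auto simp: majority_colouring_iff F_def W_def)
    with \<chi> show ?thesis by blast
  qed
qed

theorem theorem8:
  fixes k :: nat and V :: "'v set"
  assumes "k \<ge> 2" and "countable V"
  shows "(\<forall>E. simple_graph V E \<longrightarrow>
            majority_choosable TYPE('c) k (k + 1) V (neighbours E)) \<and>
         (\<forall>A. simple_digraph V A \<and> acyclic A \<longrightarrow>
            majority_choosable TYPE('c) k (k + 1) V (outneighbours A))"
proof -
  have "k > 0" using assms by simp
  have "majority_choosable TYPE('c) k (k + 1) V (neighbours E)" if "simple_graph V E" for E
    using finitely_majority_colourable_graph[OF that \<open>k > 0\<close>] \<open>k > 0\<close> \<open>countable V\<close>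
    by (rule majority_choosable_if_finitely_majority_colourable)
      (use that in \<open>auto simp: simple_graph_def neighbours_def\<close>)
  moreover have "majority_choosable TYPE('c) k (k + 1) V (outneighbours A)"
    if "simple_digraph V A" "acyclic A" for A
    using finitely_majority_colourable_acyclic_digraph[OF that(2) \<open>k > 0\<close>] \<open>k > 0\<close> \<open>countable V\<close>
    by (rule majority_choosable_if_finitely_majority_colourable)
      (use that in \<open>auto simp: simple_digraph_def outneighbours_def\<close>)
  ultimately show ?thesis by blast
qed

end
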